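(* For all integers $r,s\ge0$, $$\rho_{<}(H_{r,s})=\lambda(H_{r,s})=\frac14 .$$
   Context: An ordered graph is a finite graph with a fixed linear order on its vertices. An ordered copy of $F$ in $H$ is an injective graph embedding (edges map to edges, not necessarily induced) of $F$ into $H$ that preserves the vertex order. For ordered graphs $F,G$ let $\operatorname{ex}_{<}(G,F)=\max\{e(H): H\subseteq G,\ H \text{ contains no ordered copy of } F\}$. The relative Turán density of $F$ is $\rho_{<}(F)=\inf_G \operatorname{ex}_{<}(G,F)/e(G)$, where the infimum is over all ordered graphs $G$ with at least one edge. A weighted forward-edge template is a triple $\mathcal T=(Q,\mu,A)$, where $Q$ is a finite label set, $\mu$ is a probability measure on $Q$, and $A\subseteq Q\times Q$. The template supports an ordered graph $F$ if there is a map (not necessarily injective) $\phi:V(F)\to Q$ such that $(\phi(i),\phi(j))\in A$ for every edge $ij$ of $F$ with $i<j$; otherwise it is $F$-avoiding. Put $w(\mathcal T)=\sum_{(q,q')\in A}\mu(q)\mu(q')$ and $\lambda(F)=\sup\{w(\mathcal T):\mathcal T\text{ is }F\text{-avoiding}\}$. For $r,s\ge0$, the hinged ordered matching $H_{r,s}$ has vertex order $a_0<a_1<\cdots<a_r<b_0<b_1<\cdots<b_{r+s}<c_0<c_1<\cdots<c_s$ and edge set $\{a_0b_0,b_0c_0\}\cup\{a_ib_i:1\le i\le r\}\cup\{b_{r+j}c_j:1\le j\le s\}$. *)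

theory Defs
  imports "HOL-Probability.Probability_Mass_Function"
begin

text \<open>Every finite linearly ordered set is order-isomorphic to a finite set of natural numbers,
  so ordered graphs are taken with vertices in \<open>nat\<close> under its usual order. This lets the infimum
  over all ordered graphs range over a set. The edge joining \<open>i\<close> and \<open>j\<close>, where \<open>i < j\<close>, is the
  pair \<open>(i, j)\<close>.\<close>

record ordered_graph =
  verts :: "nat set"
  edges :: "(nat \<times> nat) set"

definition wf_ograph :: "ordered_graph \<Rightarrow> bool" where
  "wf_ograph G \<longleftrightarrow> finite (verts G) \<and>
     (\<forall>(i, j) \<in> edges G. i \<in> verts G \<and> j \<in> verts G \<and> i < j)"

definition subgraph :: "ordered_graph \<Rightarrow> ordered_graph \<Rightarrow> bool" where
  "subgraph H G \<longleftrightarrow> wf_ograph H \<and> verts H \<subseteq> verts G \<and> edges H \<subseteq> edges G"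

definition ordered_copy :: "(nat \<Rightarrow> nat) \<Rightarrow> ordered_graph \<Rightarrow> ordered_graph \<Rightarrow> bool" where
  "ordered_copy f F H \<longleftrightarrow> f ` verts F \<subseteq> verts H \<and> strict_mono_on (verts F) f \<and>
     (\<forall>(i, j) \<in> edges F. (f i, f j) \<in> edges H)"

definition contains_copy :: "ordered_graph \<Rightarrow> ordered_graph \<Rightarrow> bool" where
  "contains_copy H F \<longleftrightarrow> (\<exists>f. ordered_copy f F H)"

definition ex_ord :: "ordered_graph \<Rightarrow> ordered_graph \<Rightarrow> nat" where
  "ex_ord G F = Max {card (edges H) | H. subgraph H G \<and> \<not> contains_copy H F}"

definition rel_turan_density :: "ordered_graph \<Rightarrow> real" where
  "rel_turan_density F =
     (INF G \<in> {G. wf_ograph G \<and> edges G \<noteq> {}}. real (ex_ord G F) / real (card (edges G)))"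

text \<open>The label set is only relevant up to bijection, so labels are natural numbers as well.
  A probability measure on the finite set \<open>Q\<close> is a \<open>pmf\<close> supported in \<open>Q\<close>; labels of \<open>Q\<close> may have
  measure zero.\<close>

record template =
  labels :: "nat set"
  weight :: "nat pmf"
  arcs :: "(nat \<times> nat) set"

definition wf_template :: "template \<Rightarrow> bool" where
  "wf_template T \<longleftrightarrow> finite (labels T) \<and> set_pmf (weight T) \<subseteq> labels T \<and>
     arcs T \<subseteq> labels T \<times> labels T"

definition supports :: "template \<Rightarrow> ordered_graph \<Rightarrow> bool" where
  "supports T F \<longleftrightarrow> (\<exists>\<phi>. \<phi> ` verts F \<subseteq> labels T \<and> (\<forall>(i, j) \<in> edges F. (\<phi> i, \<phi> j) \<in> arcs T))"

definition template_density :: "template \<Rightarrow> real" where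
  "template_density T = (\<Sum>(q, q') \<in> arcs T. pmf (weight T) q * pmf (weight T) q')"

definition template_lambda :: "ordered_graph \<Rightarrow> real" where
  "template_lambda F = (SUP T \<in> {T. wf_template T \<and> \<not> supports T F}. template_density T)"

text \<open>The vertices \<open>a\<^sub>0 < \<dots> < a\<^sub>r < b\<^sub>0 < \<dots> < b\<^sub>r\<^sub>+\<^sub>s < c\<^sub>0 < \<dots> < c\<^sub>s\<close> of the hinged matching are
  numbered consecutively from \<open>0\<close>.\<close>

definition a_vert :: "nat \<Rightarrow> nat" where
  "a_vert i = i"

definition b_vert :: "nat \<Rightarrow> nat \<Rightarrow> nat" where
  "b_vert r i = (r + 1) + i"

definition c_vert :: "nat \<Rightarrow> nat \<Rightarrow> nat \<Rightarrow> nat" where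
  "c_vert r s i = (r + 1) + (r + s + 1) + i"

definition hinged_matching :: "nat \<Rightarrow> nat \<Rightarrow> ordered_graph" where
  "hinged_matching r s =
     \<lparr> verts = a_vert ` {0..r} \<union> b_vert r ` {0..r + s} \<union> c_vert r s ` {0..s},
       edges = {(a_vert 0, b_vert r 0), (b_vert r 0, c_vert r s 0)}
         \<union> {(a_vert i, b_vert r i) | i. 1 \<le> i \<and> i \<le> r}
         \<union> {(b_vert r (r + j), c_vert r s j) | j. 1 \<le> j \<and> j \<le> s} \<rparr>"

lemma wf_hinged_matching: "wf_ograph (hinged_matching r s)"
  by (auto simp: wf_ograph_def hinged_matching_def a_vert_def b_vert_def c_vert_def)

end

theory Submission
  imports Defs "HOL-Real_Asymp.Real_Asymp"
begin

text \<open>A template may map the vertices of a graph to labels without regard to order, so it supports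
  \<open>H\<^sub>r\<^sub>,\<^sub>s\<close> as soon as it has a directed walk with two arcs, and it avoids \<open>H\<^sub>r\<^sub>,\<^sub>s\<close> only if no label is both
  a source and a target. Its arcs then go from a set \<open>X\<close> to a disjoint set \<open>Y\<close>, and its density is at
  most \<open>\<mu>(X) \<mu>(Y) \<le> 1/4\<close>. Likewise, the edges of any ordered graph from a vertex set to its complement
  contain no monotone path with two edges, hence no \<open>H\<^sub>r\<^sub>,\<^sub>s\<close>, and for a random vertex set these are on average
  a quarter of all edges. This gives \<open>\<lambda> = 1/4 \<le> \<rho>\<close>.

  For \<open>\<rho> \<le> 1/4\<close>, one needs host graphs in which every subgraph with noticeably more than a quarter of
  the edges contains \<open>H\<^sub>r\<^sub>,\<^sub>s\<close>. Take a Sidon set \<open>B\<close> with \<open>m\<close> elements and join two numbers in \<open>[0, n)\<close>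
  if their difference is a difference of two elements of \<open>B\<close>. By the Sidon property the edges of this
  graph are partitioned by the translates of \<open>-B\<close>, each a clique. For a vertex set \<open>X\<close> let \<open>k\<^sub>i\<close> be
  the number of its elements in the \<open>i\<close>-th translate. All out-degrees are at most \<open>m (m - 1) / 2\<close>,
  so the number of edges that leave \<open>X\<close> is at most
  \<open>|X| m (m - 1) / 2 - \<Sum> k\<^sub>i (k\<^sub>i - 1) / 2 = \<Sum> (m k\<^sub>i - k\<^sub>i\<^sup>2) / 2\<close>, because \<open>\<Sum> k\<^sub>i = m |X|\<close>. Every summand
  is at most \<open>m\<^sup>2 / 8\<close> and there are about \<open>n\<close> translates, against about \<open>n m\<^sup>2 / 2\<close> edges: no directed
  cut has much more than a quarter of the edges (lemma \<open>card_directed_cut_difference_graph\<close>).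

  The parallel edges of \<open>H\<^sub>r\<^sub>,\<^sub>s\<close> come from translation. In a subgraph \<open>H\<close>, all but few edges
  \<open>(x, x + g)\<close> have many translates \<open>(x', x' + g)\<close> in \<open>H\<close> with \<open>x'\<close> slightly above \<open>x\<close>
  (lemma \<open>card_points_with_few_successors\<close>). Discard the exceptional edges. If a path
  \<open>a\<^sub>0 < b\<^sub>0 < c\<^sub>0\<close> is left, then short translations of \<open>a\<^sub>0b\<^sub>0\<close> and longer translations of \<open>b\<^sub>0c\<^sub>0\<close> complete
  it to a copy of \<open>H\<^sub>r\<^sub>,\<^sub>s\<close> (lemma \<open>contains_hinged_matching_of_windows\<close>); the vertices are in the right
  order if all translations are shorter than the least difference. So if \<open>H\<close> contains no copy, the
  edges that are left form a subset of a directed cut. Letting \<open>B\<close> consist of \<open>k\<close> consecutive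
  powers of two times \<open>k\<^sup>2\<close>, and \<open>n\<close> be much larger than its maximum, all error terms vanish as \<open>k\<close>
  tends to infinity.\<close>

section \<open>Avoiding templates\<close>

lemma supports_hinged_matching_iff:
  assumes "wf_template T"
  shows "supports T (hinged_matching r s) \<longleftrightarrow> (\<exists>p q t. (p, q) \<in> arcs T \<and> (q, t) \<in> arcs T)"
proof
  assume "supports T (hinged_matching r s)"
  then show "\<exists>p q t. (p, q) \<in> arcs T \<and> (q, t) \<in> arcs T"
    unfolding supports_def hinged_matching_def by auto
next
  assume "\<exists>p q t. (p, q) \<in> arcs T \<and> (q, t) \<in> arcs T"
  then obtain p q t where walk: "(p, q) \<in> arcs T" "(q, t) \<in> arcs T"
    by blast
  have "{p, q, t} \<subseteq> labels T"
    using assms walk by (auto simp: wf_template_def)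
  \<comment> \<open>Every \<open>ab\<close> edge goes to the first arc and every \<open>bc\<close> edge to the second.\<close>
  moreover define \<phi> where
    "\<phi> v = (if v \<le> r then p else if v \<le> r + 1 + (r + s) then q else t)" for v
  ultimately have "\<phi> ` verts (hinged_matching r s) \<subseteq> labels T"
    by auto
  moreover have "\<forall>(i, j) \<in> edges (hinged_matching r s). (\<phi> i, \<phi> j) \<in> arcs T"
    using walk by (auto simp: hinged_matching_def \<phi>_def a_vert_def b_vert_def c_vert_def)
  ultimately show "supports T (hinged_matching r s)"
    unfolding supports_def by blast
qed

lemma template_density_le_quarter:
  assumes wf: "wf_template T"
    and no_walk: "\<nexists>p q t. (p, q) \<in> arcs T \<and> (q, t) \<in> arcs T"
  shows "template_density T \<le> 1 / 4"
proof -
  define X Y where "X = fst ` arcs T" and "Y = snd ` arcs T"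
  let ?\<mu> = "pmf (weight T)"
  have "arcs T \<subseteq> labels T \<times> labels T" "finite (labels T)"
    using wf by (auto simp: wf_template_def)
  then have "finite (arcs T)"
    by (meson finite_SigmaI finite_subset)
  then have fin: "finite X" "finite Y"
    by (auto simp: X_def Y_def)
  have disj: "X \<inter> Y = {}"
    using no_walk by (force simp: X_def Y_def)
  have "template_density T \<le> (\<Sum>(q, q') \<in> X \<times> Y. ?\<mu> q * ?\<mu> q')"
    unfolding template_density_def using fin
    by (intro sum_mono2) (force simp: X_def Y_def)+
  also have "\<dots> = sum ?\<mu> X * sum ?\<mu> Y"
    by (simp add: sum_product sum.cartesian_product)
  also have "\<dots> \<le> ((sum ?\<mu> X + sum ?\<mu> Y) / 2)\<^sup>2"
    using zero_le_power2[of "sum ?\<mu> X - sum ?\<mu> Y"] by (simp add: power2_eq_square field_simps)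
  also have "\<dots> \<le> (1 / 2)\<^sup>2"
  proof (intro power_mono divide_right_mono)
    have "sum ?\<mu> X + sum ?\<mu> Y = measure_pmf.prob (weight T) (X \<union> Y)"
      using fin disj by (simp add: measure_measure_pmf_finite sum.union_disjoint)
    then show "sum ?\<mu> X + sum ?\<mu> Y \<le> 1"
      by simp
  qed (auto intro!: add_nonneg_nonneg sum_nonneg)
  finally show ?thesis
    by (simp add: power2_eq_square)
qed

lemma template_lambda_hinged_matching: "template_lambda (hinged_matching r s) = 1 / 4"
proof -
  define T where "T = \<lparr> labels = {0, 1}, weight = pmf_of_set {0, 1 :: nat}, arcs = {(0, 1 :: nat)} \<rparr>"
  have wf: "wf_template T"
    by (auto simp: wf_template_def T_def)
  have "\<not> supports T (hinged_matching r s)"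
    unfolding supports_hinged_matching_iff[OF wf] by (auto simp: T_def)
  moreover have "template_density T = 1 / 4"
    by (simp add: template_density_def T_def)
  ultimately have "1 / 4 \<in> template_density ` {T. wf_template T \<and> \<not> supports T (hinged_matching r s)}"
    using wf by (intro image_eqI[of _ _ T]) auto
  then show ?thesis
    unfolding template_lambda_def
    by (rule cSup_eq_maximum) (use template_density_le_quarter supports_hinged_matching_iff in blast)
qed

section \<open>Directed cuts give the lower bound\<close>

text \<open>The path is the image of \<open>a\<^sub>0 b\<^sub>0 c\<^sub>0\<close>. It is what a directed cut cannot contain.\<close>

lemma contains_hinged_matching_imp_path:
  assumes "contains_copy G (hinged_matching r s)"
  shows "\<exists>x y z. (x, y) \<in> edges G \<and> (y, z) \<in> edges G"
  using assms unfolding contains_copy_def ordered_copy_def hinged_matching_def by auto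

lemma finite_edges: "wf_ograph G \<Longrightarrow> finite (edges G)"
  unfolding wf_ograph_def
  by (rule finite_subset[of _ "verts G \<times> verts G"]) auto

lemma finite_subgraph_sizes:
  assumes "wf_ograph G"
  shows "finite {card (edges H) | H. subgraph H G \<and> \<not> contains_copy H F}"
proof (rule finite_subset)
  show "{card (edges H) | H. subgraph H G \<and> \<not> contains_copy H F} \<subseteq> {..card (edges G)}"
    using card_mono[OF finite_edges[OF assms]] unfolding subgraph_def by blast
qed simp

lemma card_edges_le_ex_ord:
  assumes "wf_ograph G" "subgraph H G" "\<not> contains_copy H F"
  shows "card (edges H) \<le> ex_ord G F"
  unfolding ex_ord_def using assms by (intro Max_ge finite_subgraph_sizes) auto

lemma ex_ord_hinged_matching_attained:
  assumes "wf_ograph G"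
  obtains H where "subgraph H G" "\<not> contains_copy H (hinged_matching r s)"
    "card (edges H) = ex_ord G (hinged_matching r s)"
proof -
  let ?sizes = "{card (edges H) | H. subgraph H G \<and> \<not> contains_copy H (hinged_matching r s)}"
  have "subgraph \<lparr>verts = {}, edges = {}\<rparr> G"
    by (auto simp: subgraph_def wf_ograph_def)
  moreover have "\<not> contains_copy \<lparr>verts = {}, edges = {}\<rparr> (hinged_matching r s)"
    using contains_hinged_matching_imp_path by fastforce
  ultimately have "?sizes \<noteq> {}"
    by blast
  then have "ex_ord G (hinged_matching r s) \<in> ?sizes"
    unfolding ex_ord_def by (intro Max_in finite_subgraph_sizes assms)
  then show ?thesis
    using that by auto
qed

lemma card_separating_subsets:
  assumes "finite V" "i \<in> V" "j \<in> V" "i \<noteq> j"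
  shows "4 * card {X \<in> Pow V. i \<in> X \<and> j \<notin> X} = 2 ^ card V"
proof -
  have "bij_betw (insert i) (Pow (V - {i, j})) {X \<in> Pow V. i \<in> X \<and> j \<notin> X}"
    using assms by (intro bij_betw_byWitness[where f' = "\<lambda>X. X - {i}"]) auto
  then have "card {X \<in> Pow V. i \<in> X \<and> j \<notin> X} = 2 ^ card (V - {i, j})"
    using assms(1) by (simp add: bij_betw_same_card[symmetric] card_Pow)
  moreover have "card V = card (V - {i, j}) + 2"
    using assms card_Diff_subset[of "{i, j}" V] card_mono[of V "{i, j}"] by simp
  ultimately show ?thesis
    by simp
qed

text \<open>A uniformly random \<open>X \<subseteq> V\<close> separates each edge, in the right direction, with probability \<open>1/4\<close>;
  the proof double counts the pairs of a set \<open>X\<close> and an edge that leaves \<open>X\<close>.\<close>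

lemma exists_large_directed_cut:
  assumes "wf_ograph G"
  shows "\<exists>X. card (edges G) \<le> 4 * card {(i, j) \<in> edges G. i \<in> X \<and> j \<notin> X}"
proof (rule ccontr)
  let ?V = "verts G" and ?E = "edges G"
  let ?cut = "\<lambda>X. {e \<in> ?E. fst e \<in> X \<and> snd e \<notin> X}"
  assume "\<not> ?thesis"
  then have small: "4 * card (?cut X) < card ?E" for X
    by (simp add: not_le case_prod_unfold)
  have fin: "finite ?V" "finite ?E"
    using assms finite_edges by (auto simp: wf_ograph_def)
  have filtered: "(\<Sum>x\<in>A. if P x then 4 else 0) = 4 * card {x \<in> A. P x}" if "finite A"
    for A :: "'z set" and P
    using that by (simp flip: sum.inter_filter)
  have "(\<Sum>X\<in>Pow ?V. 4 * card (?cut X)) = (\<Sum>X\<in>Pow ?V. \<Sum>e\<in>?E. if fst e \<in> X \<and> snd e \<notin> X then 4 else 0)"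
    unfolding filtered[OF fin(2)] ..
  also have "\<dots> = (\<Sum>e\<in>?E. 4 * card {X \<in> Pow ?V. fst e \<in> X \<and> snd e \<notin> X})"
    using fin by (subst sum.swap) (simp add: filtered)
  also have "\<dots> = (\<Sum>e\<in>?E. 2 ^ card ?V)"
    using assms fin by (intro sum.cong refl card_separating_subsets) (auto simp: wf_ograph_def)
  also have "\<dots> = (\<Sum>X\<in>Pow ?V. card ?E)"
    using fin by (simp add: card_Pow)
  finally have "(\<Sum>X\<in>Pow ?V. 4 * card (?cut X)) = (\<Sum>X\<in>Pow ?V. card ?E)" .
  moreover have "(\<Sum>X\<in>Pow ?V. 4 * card (?cut X)) < (\<Sum>X\<in>Pow ?V. card ?E)"
    using fin small by (intro sum_strict_mono) auto
  ultimately show False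
    by simp
qed

lemma quarter_le_ex_ord_hinged_matching:
  assumes "wf_ograph G"
  shows "card (edges G) \<le> 4 * ex_ord G (hinged_matching r s)"
proof -
  obtain X where X: "card (edges G) \<le> 4 * card {(i, j) \<in> edges G. i \<in> X \<and> j \<notin> X}"
    using exists_large_directed_cut[OF assms] by blast
  define H where "H = \<lparr>verts = verts G, edges = {(i, j) \<in> edges G. i \<in> X \<and> j \<notin> X}\<rparr>"
  have "subgraph H G"
    using assms by (auto simp: subgraph_def wf_ograph_def H_def)
  moreover have "\<not> contains_copy H (hinged_matching r s)"
    using contains_hinged_matching_imp_path[of H r s] by (auto simp: H_def)
  ultimately have "card (edges H) \<le> ex_ord G (hinged_matching r s)"
    by (rule card_edges_le_ex_ord[OF assms])
  then show ?thesis
    using X by (simp add: H_def)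
qed

section \<open>Directed cuts of Sidon difference graphs\<close>

definition gaps :: "nat set \<Rightarrow> nat set" where
  "gaps B = {b - b' | b b'. b \<in> B \<and> b' \<in> B \<and> b' < b}"

text \<open>Quantifying over positive differences only excludes the trivial coincidence \<open>b - b = c - c\<close>
  and truncated subtraction.\<close>

definition sidon :: "nat set \<Rightarrow> bool" where
  "sidon B \<longleftrightarrow> (\<forall>b\<in>B. \<forall>b'\<in>B. \<forall>c\<in>B. \<forall>c'\<in>B. b' < b \<longrightarrow> c' < c \<longrightarrow> b - b' = c - c' \<longrightarrow> b = c \<and> b' = c')"

definition difference_graph :: "nat \<Rightarrow> nat set \<Rightarrow> ordered_graph" where
  "difference_graph n D = \<lparr>verts = {..<n}, edges = {(x, y). x < y \<and> y < n \<and> y - x \<in> D}\<rparr>"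

lemma wf_difference_graph: "wf_ograph (difference_graph n D)"
  by (auto simp: wf_ograph_def difference_graph_def)

lemma finite_gaps: "finite B \<Longrightarrow> finite (gaps B)"
  by (rule finite_subset[of _ "(\<lambda>(b, b'). b - b') ` (B \<times> B)"]) (auto simp: gaps_def)

lemma card_gaps:
  assumes "finite B" "sidon B"
  shows "2 * card (gaps B) = card B * (card B - 1)"
proof -
  let ?P = "{(b, b'). b \<in> B \<and> b' \<in> B \<and> b' < b}"
  have fin: "finite ?P"
    using assms(1) by (rule_tac finite_subset[of _ "B \<times> B"]) auto
  have "gaps B = (\<lambda>(b, b'). b - b') ` ?P"
    by (auto simp: gaps_def)
  moreover have "inj_on (\<lambda>(b, b'). b - b') ?P"
    using assms(2) by (auto simp: sidon_def intro!: inj_onI)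
  ultimately have "card (gaps B) = card ?P"
    by (simp add: card_image)
  moreover have "B \<times> B = ?P \<union> ?P\<inverse> \<union> (\<lambda>b. (b, b)) ` B"
    by (auto simp: image_iff)
  then have "card (B \<times> B) = card (?P \<union> ?P\<inverse>) + card ((\<lambda>b. (b, b)) ` B)"
    using fin assms(1) by (simp only:) (rule card_Un_disjoint, auto)
  moreover have "card (?P \<union> ?P\<inverse>) = card ?P + card (?P\<inverse>)"
    using fin by (intro card_Un_disjoint) auto
  moreover have "card ((\<lambda>b. (b, b)) ` B) = card B"
    by (intro card_image) (auto simp: inj_on_def)
  ultimately show ?thesis
    by (simp add: card_cartesian_product diff_mult_distrib2)
qed

text \<open>Let \<open>K i\<close> be the set of \<open>(b, x)\<close> with \<open>b + x = i\<close> and \<open>x \<in> X\<close>; its size is the number of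
  elements of \<open>X\<close> in the translate \<open>i - B\<close>. Two different members of \<open>K i\<close> have \<open>X\<close>-components that
  are joined by an edge, and by the Sidon property that edge determines both members. Hence
  \<open>\<Sum> |K i|\<^sup>2\<close> is at most \<open>|B| |X|\<close> plus twice the number of edges inside \<open>X\<close>, which bounds that number
  from below; the edges that leave \<open>X\<close> are then bounded through the out-degrees.\<close>

lemma card_directed_cut_difference_graph:
  assumes B: "finite B" "sidon B" "B \<subseteq> {..M}" and X: "X \<subseteq> {..<n}"
  shows "8 * card {(x, y) \<in> edges (difference_graph n (gaps B)). x \<in> X \<and> y \<notin> X}
    \<le> (card B)\<^sup>2 * (n + M)"
proof -
  let ?E = "edges (difference_graph n (gaps B))" and ?m = "card B"
  define C J where "C = {(x, y) \<in> ?E. x \<in> X \<and> y \<notin> X}" and "J = {(x, y) \<in> ?E. x \<in> X \<and> y \<in> X}"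
  have fin_X: "finite X"
    using X finite_subset by blast
  have fin_E: "finite ?E"
    by (rule finite_edges[OF wf_difference_graph])
  have fin: "finite C" "finite J"
    by (auto intro: finite_subset[OF _ fin_E] simp: C_def J_def)

  \<comment> \<open>Each vertex of \<open>X\<close> is the lower end of at most one edge per gap.\<close>
  have "card C + card J = card (C \<union> J)"
    using fin by (intro card_Un_disjoint[symmetric]) (auto simp: C_def J_def)
  also have "C \<union> J \<subseteq> (\<lambda>(x, g). (x, x + g)) ` (X \<times> gaps B)"
    by (force simp: C_def J_def difference_graph_def image_iff)
  then have "card (C \<union> J) \<le> card X * card (gaps B)"
    using surj_card_le[of "X \<times> gaps B" "C \<union> J" "\<lambda>(x, g). (x, x + g)"] fin_X finite_gaps[OF B(1)]
    by (simp add: card_cartesian_product)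
  finally have "2 * card C + 2 * card J \<le> card X * (2 * card (gaps B))"
    by simp
  then have out_degrees: "2 * card C + 2 * card J + ?m * card X \<le> ?m\<^sup>2 * card X"
    unfolding card_gaps[OF B(1,2)] by (cases ?m) (simp_all add: power2_eq_square algebra_simps)

  define K where "K i = {p \<in> B \<times> X. fst p + snd p = i}" for i
  have fin_K: "finite (K i)" for i
    using B(1) fin_X by (simp add: K_def)
  have "B \<times> X = (\<Union>i<n + M. K i)"
    using B(3) X by (fastforce simp: K_def)
  then have "card (B \<times> X) = (\<Sum>i<n + M. card (K i))"
    using fin_K by (simp only:) (rule card_UN_disjoint, auto simp: K_def)
  then have sum_K: "(\<Sum>i<n + M. card (K i)) = ?m * card X"
    by (simp add: card_cartesian_product)
  \<comment> \<open>Ordered pairs of members of the same translate, split into diagonal and edges inside \<open>X\<close>.\<close>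
  define Q where "Q = (\<Union>i<n + M. K i \<times> K i)"
  have fin_Q: "finite Q"
    using fin_K by (simp add: Q_def)
  have "card Q = (\<Sum>i<n + M. card (K i \<times> K i))"
    unfolding Q_def using fin_K by (intro card_UN_disjoint) (auto simp: K_def)
  then have card_Q: "card Q = (\<Sum>i<n + M. (card (K i))\<^sup>2)"
    by (simp add: card_cartesian_product power2_eq_square)
  let ?diag = "(\<lambda>p. (p, p)) ` (B \<times> X)"
  have "card Q \<le> card ?diag + card (Q - ?diag)"
    using diff_card_le_card_Diff[of ?diag Q] B(1) fin_X by simp
  also have "card ?diag = ?m * card X"
    by (subst card_image) (auto simp: inj_on_def card_cartesian_product)
  also have "card (Q - ?diag) \<le> card (J \<union> J\<inverse>)"
  proof (rule card_inj_on_le[of "\<lambda>(p, p'). (snd p, snd p')"])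
    show "inj_on (\<lambda>(p, p'). (snd p, snd p')) (Q - ?diag)"
    proof (rule inj_onI, clarsimp)
      fix b b' c c' x x'
      assume "((b, x), (b', x')) \<in> Q" "((c, x), (c', x')) \<in> Q"
        and off: "((b, x), (b', x')) \<notin> ?diag" "((c, x), (c', x')) \<notin> ?diag"
      then have mem: "b \<in> B" "b' \<in> B" "c \<in> B" "c' \<in> B"
        and eq: "b + x = b' + x'" "c + x = c' + x'" and "x \<in> X" "x' \<in> X"
        by (auto simp: Q_def K_def)
      with off have "x \<noteq> x'"
        by (auto simp: image_iff)
      then consider "x < x'" | "x' < x"
        by linarith
      then show "b = c \<and> b' = c'"
      proof cases
        case 1
        with eq have "b' < b" "c' < c" "b - b' = c - c'"
          by linarith+
        with B(2) mem show ?thesis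
          unfolding sidon_def by blast
      next
        case 2
        with eq have "b < b'" "c < c'" "b' - b = c' - c"
          by linarith+
        with B(2) mem show ?thesis
          unfolding sidon_def by blast
      qed
    qed
    show "(\<lambda>(p, p'). (snd p, snd p')) ` (Q - ?diag) \<subseteq> J \<union> J\<inverse>"
    proof (rule image_subsetI, unfold split_paired_all split_conv snd_conv)
      fix b b' x x'
      assume "((b, x), (b', x')) \<in> Q - ?diag"
      then have mem: "b \<in> B" "b' \<in> B" "x \<in> X" "x' \<in> X" and eq: "b + x = b' + x'"
        and off: "((b, x), (b', x')) \<notin> ?diag"
        by (auto simp: Q_def K_def)
      have lt: "x < n" "x' < n"
        using mem X by auto
      from off mem eq have "x \<noteq> x'"
        by (auto simp: image_iff)
      then consider "x < x'" "x' - x = b - b'" "b' < b" | "x' < x" "x - x' = b' - b" "b < b'"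
        using eq by linarith
      then show "(x, x') \<in> J \<union> J\<inverse>"
      proof cases
        case 1
        then show ?thesis
          using mem lt unfolding J_def difference_graph_def gaps_def by auto
      next
        case 2
        then show ?thesis
          using mem lt unfolding J_def difference_graph_def gaps_def by auto
      qed
    qed
  qed (use fin in auto)
  also have "card (J \<union> J\<inverse>) \<le> 2 * card J"
    using card_Un_le[of J "J\<inverse>"] by simp
  finally have "2 * card C + (\<Sum>i<n + M. (card (K i))\<^sup>2) \<le> (\<Sum>i<n + M. ?m * card (K i))"
    using out_degrees
    unfolding card_Q sum_distrib_left[symmetric] sum_K by (simp add: power2_eq_square)
  then have "2 * real (card C) \<le> (\<Sum>i<n + M. real ?m * real (card (K i)) - (real (card (K i)))\<^sup>2)"
    unfolding sum_subtractf by (simp flip: of_nat_power of_nat_mult of_nat_sum)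
  also have "\<dots> \<le> (\<Sum>i<n + M. (real ?m)\<^sup>2 / 4)"
  proof (rule sum_mono)
    fix i
    show "real ?m * real (card (K i)) - (real (card (K i)))\<^sup>2 \<le> (real ?m)\<^sup>2 / 4"
      using zero_le_power2[of "real ?m - 2 * real (card (K i))"]
      by (simp add: power2_eq_square algebra_simps)
  qed
  finally have "real (8 * card C) \<le> real (?m\<^sup>2 * (n + M))"
    by (simp add: mult.commute)
  then show ?thesis
    unfolding C_def of_nat_le_iff .
qed

text \<open>The first \<open>n - M\<close> vertices have full out-degree.\<close>

lemma card_difference_graph_ge:
  assumes "finite D" "D \<subseteq> {1..M}"
  shows "card D * (n - M) \<le> card (edges (difference_graph n D))"
proof -
  have "(\<lambda>(g, x). (x, x + g)) ` (D \<times> {..<n - M}) \<subseteq> edges (difference_graph n D)"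
    using assms by (fastforce simp: difference_graph_def)
  moreover have "inj_on (\<lambda>(g, x). (x, x + g)) (D \<times> {..<n - M})"
    by (auto simp: inj_on_def)
  ultimately have "card (D \<times> {..<n - M}) \<le> card (edges (difference_graph n D))"
    using finite_edges[OF wf_difference_graph] card_inj_on_le by blast
  then show ?thesis
    by (simp add: card_cartesian_product)
qed

section \<open>Hinged matchings from translated edges\<close>

text \<open>Cut \<open>[0, n)\<close> into blocks of length \<open>W\<close>. All exceptional points of a block lie within distance
  \<open>W\<close> above its least exceptional point, so a block has at most \<open>K\<close> of them.\<close>

lemma card_points_with_few_successors:
  assumes S: "S \<subseteq> {..<n}" and W: "0 < W"
  shows "card {x \<in> S. card (S \<inter> {x<..<x + W}) < K} \<le> K * (n div W + 1)"
proof -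
  define Z where "Z = {x \<in> S. card (S \<inter> {x<..<x + W}) < K}"
  have fin: "finite S" "finite Z"
    using finite_subset[OF S] by (auto simp: Z_def)
  have block: "card {x \<in> Z. x div W = q} \<le> K" for q
  proof (cases "{x \<in> Z. x div W = q} = {}")
    case False
    define z where "z = Min {x \<in> Z. x div W = q}"
    have z: "z \<in> Z" "z div W = q" "\<And>x. x \<in> Z \<Longrightarrow> x div W = q \<Longrightarrow> z \<le> x"
      using Min_in[OF _ False] fin(2) by (auto simp: z_def)
    have "x < z + W" if "x div W = q" for x
    proof -
      have "x = q * W + x mod W" "z = q * W + z mod W"
        using that z(2) by (metis div_mult_mod_eq)+
      then show ?thesis
        using mod_less_divisor[OF W, of x] by linarith
    qed
    then have "{x \<in> Z. x div W = q} \<subseteq> insert z (S \<inter> {z<..<z + W})"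
      using z(3) by (fastforce simp: Z_def order.strict_iff_order)
    then have "card {x \<in> Z. x div W = q} \<le> Suc (card (S \<inter> {z<..<z + W}))"
      using fin card_mono[of "insert z (S \<inter> {z<..<z + W})"] card_insert_le_m1[of "Suc (card (S \<inter> {z<..<z + W}))"]
      by fastforce
    also have "\<dots> \<le> K"
      using z(1) by (simp add: Z_def)
    finally show ?thesis .
  qed (simp only: card.empty le0)
  have "Z \<subseteq> (\<Union>q\<le>n div W. {x \<in> Z. x div W = q})"
  proof
    fix x assume "x \<in> Z"
    then have "x \<le> n"
      using S by (auto simp: Z_def)
    with \<open>x \<in> Z\<close> show "x \<in> (\<Union>q\<le>n div W. {x \<in> Z. x div W = q})"
      by (simp add: div_le_mono)
  qed
  then have "card Z \<le> card (\<Union>q\<le>n div W. {x \<in> Z. x div W = q})"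
    using fin by (intro card_mono) auto
  also have "\<dots> \<le> (\<Sum>q\<le>n div W. card {x \<in> Z. x div W = q})"
    by (intro card_UN_le) simp
  also have "\<dots> \<le> (\<Sum>q\<le>n div W. K)"
    by (intro sum_mono block)
  finally show ?thesis
    by (simp add: Z_def mult.commute)
qed

lemma strict_mono_enumeration:
  fixes S :: "nat set"
  assumes "K \<le> card S"
  shows "\<exists>f. strict_mono_on {..<K} f \<and> f ` {..<K} \<subseteq> S"
proof (cases "finite S")
  case True
  have "strict_mono_on {..<K} ((!) (sorted_list_of_set S))"
    using assms by (intro strict_mono_onI)
      (auto intro!: sorted_wrt_nth_less[OF strict_sorted_list_of_set])
  moreover have "(!) (sorted_list_of_set S) ` {..<K} \<subseteq> S"
    using assms True nth_mem[of _ "sorted_list_of_set S"] by fastforce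
  ultimately show ?thesis
    by blast
next
  case False
  then show ?thesis
    using assms by (auto simp: strict_mono_on_def)
qed

text \<open>A single increasing sequence of offsets \<open>\<kappa>\<close> positions all the \<open>b\<^sub>i\<close>. The edges \<open>a\<^sub>i b\<^sub>i\<close> are
  translates of \<open>a\<^sub>0 b\<^sub>0\<close> by the first offsets, the edges \<open>b\<^sub>r\<^sub>+\<^sub>j c\<^sub>j\<close> translates of \<open>b\<^sub>0 c\<^sub>0\<close> by the last
  ones, so the order within each of the three groups is the order of the offsets.\<close>

lemma contains_hinged_matchingI:
  assumes wf: "wf_ograph G"
    and \<kappa>: "strict_mono_on {..r + s} \<kappa>" "\<kappa> 0 = 0"
    and below: "a + \<kappa> r < b" "b + \<kappa> (r + s) < c"
    and left: "\<And>i. i \<le> r \<Longrightarrow> (a + \<kappa> i, b + \<kappa> i) \<in> edges G"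
    and hinge: "(b, c) \<in> edges G"
    and right: "\<And>j. 1 \<le> j \<Longrightarrow> j \<le> s \<Longrightarrow> (b + \<kappa> (r + j), c + \<kappa> (r + j)) \<in> edges G"
  shows "contains_copy G (hinged_matching r s)"
proof -
  \<comment> \<open>The offsets of the \<open>c\<^sub>j\<close>: the edge at \<open>c\<^sub>0\<close> starts at \<open>b\<^sub>0\<close>, not at \<open>b\<^sub>r\<close>.\<close>
  define \<theta> where "\<theta> j = (if j = 0 then c else c + \<kappa> (r + j))" for j
  define f where "f v = (if v \<le> r then a + \<kappa> v else if v \<le> r + 1 + (r + s) then b + \<kappa> (v - (r + 1))
    else \<theta> (v - (r + 1 + (r + s + 1))))" for v
  have f_a: "f (a_vert i) = a + \<kappa> i" if "i \<le> r" for i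
    using that by (simp add: f_def a_vert_def)
  have f_b: "f (b_vert r i) = b + \<kappa> i" if "i \<le> r + s" for i
    using that by (simp add: f_def b_vert_def)
  have f_c: "f (c_vert r s j) = \<theta> j" for j
    by (simp add: f_def c_vert_def)
  have less: "\<kappa> i < \<kappa> j" if "i < j" "j \<le> r + s" for i j
    using \<kappa>(1) that by (auto simp: strict_mono_on_def)
  have le: "\<kappa> i \<le> \<kappa> j" if "i \<le> j" "j \<le> r + s" for i j
    using less[of i j] that by (cases "i = j") auto
  have \<theta>_less: "\<theta> i < \<theta> j" if "i < j" "j \<le> s" for i j
    using less[of 0 "r + j"] less[of "r + i" "r + j"] that \<kappa>(2) by (auto simp: \<theta>_def)
  have \<theta>_ge: "c \<le> \<theta> j" for j
    by (simp add: \<theta>_def)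
  have edges: "(f i, f j) \<in> edges G" if "(i, j) \<in> edges (hinged_matching r s)" for i j
    using that left[of 0] \<kappa>(2) left hinge right
    by (auto simp: hinged_matching_def f_a f_b f_c \<theta>_def)
  have "f ` verts (hinged_matching r s) \<subseteq> verts G"
  proof -
    have "a + \<kappa> i \<in> verts G \<and> b + \<kappa> i \<in> verts G" if "i \<le> r" for i
      using left[OF that] wf by (auto simp: wf_ograph_def)
    moreover have "b + \<kappa> i \<in> verts G" if "r < i" "i \<le> r + s" for i
    proof -
      have "(b + \<kappa> i, c + \<kappa> i) \<in> edges G"
        using right[of "i - r"] that by simp
      then show ?thesis
        using wf by (auto simp: wf_ograph_def)
    qed
    moreover have "\<theta> j \<in> verts G" if "j \<le> s" for j
      using right[of j] hinge that wf by (auto simp: wf_ograph_def \<theta>_def)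
    ultimately show ?thesis
      by (auto simp: hinged_matching_def f_a f_b f_c) (meson not_le)
  qed
  moreover have "strict_mono_on (verts (hinged_matching r s)) f"
  proof (rule strict_mono_onI)
    fix u v assume uv: "u \<in> verts (hinged_matching r s)" "v \<in> verts (hinged_matching r s)" "u < v"
    have a_less_b: "a + \<kappa> i < b + \<kappa> j" if "i \<le> r" for i j
      using le[of i r] that below(1) by simp
    have b_less_c: "b + \<kappa> i < \<theta> j" if "i \<le> r + s" for i j
      using le[of i "r + s"] \<theta>_ge[of j] that below(2) by simp
    have a_less_c: "a + \<kappa> i < \<theta> j" if "i \<le> r" for i j
      using a_less_b[of i 0] b_less_c[of 0 j] that by simp
    from uv show "f u < f v"
      unfolding hinged_matching_def
      by (auto simp: f_a f_b f_c intro!: less \<theta>_less a_less_b b_less_c a_less_c)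
        (auto simp: a_vert_def b_vert_def c_vert_def)
  qed
  ultimately show ?thesis
    using edges unfolding contains_copy_def ordered_copy_def by blast
qed

text \<open>The translates of \<open>b\<^sub>0 c\<^sub>0\<close> have to start above \<open>b\<^sub>r\<close>, which lies at most \<open>V\<close> above \<open>b\<^sub>0\<close>. Asking
  for \<open>s + V\<close> translates in the long window leaves \<open>s\<close> of them beyond distance \<open>V\<close>. Since all
  nonzero offsets are below \<open>W\<close>, the bounds \<open>W \<le> g\<close> and \<open>W \<le> h\<close> keep the three groups of vertices apart.\<close>

lemma contains_hinged_matching_of_windows:
  assumes wf: "wf_ograph G"
    and ab: "(a, a + g) \<in> edges G" "W \<le> g" and bc: "(a + g, a + g + h) \<in> edges G" "W \<le> h"
    and VW: "V \<le> W"
    and left: "r \<le> card ({x. (x, x + g) \<in> edges G} \<inter> {a<..<a + V})"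
    and right: "s + V \<le> card ({x. (x, x + h) \<in> edges G} \<inter> {a + g<..<a + g + W})"
  shows "contains_copy G (hinged_matching r s)"
proof -
  define b where "b = a + g"
  obtain p where p: "strict_mono_on {..<r} p"
    "p ` {..<r} \<subseteq> {x. (x, x + g) \<in> edges G} \<inter> {a<..<a + V}"
    using strict_mono_enumeration[OF left] by blast
  let ?S = "{x. (x, x + h) \<in> edges G} \<inter> {b<..<b + W}"
  have "s \<le> card (?S - {b<..b + V})"
    using right diff_card_le_card_Diff[of "{b<..b + V}" ?S] by (simp add: b_def)
  then obtain q where q: "strict_mono_on {..<s} q" "q ` {..<s} \<subseteq> ?S - {b<..b + V}"
    using strict_mono_enumeration by blast
  have p_mem: "(p i, p i + g) \<in> edges G" "a < p i" "p i < a + V" if "i < r" for i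
    using p(2) that by (auto simp: image_subset_iff)
  have q_mem: "(q j, q j + h) \<in> edges G" "b + V < q j" "q j < b + W" if "j < s" for j
    using q(2) that by (fastforce simp: image_subset_iff)+
  define \<kappa> where "\<kappa> i = (if i = 0 then 0 else if i \<le> r then p (i - 1) - a else q (i - r - 1) - b)" for i
  have \<kappa>_left: "a + \<kappa> i = p (i - 1) \<and> 0 < \<kappa> i \<and> \<kappa> i < V" if "0 < i" "i \<le> r" for i
  proof -
    have "i - 1 < r"
      using that by simp
    with p_mem(2,3)[OF this] that show ?thesis
      by (simp add: \<kappa>_def)
  qed
  have \<kappa>_right: "b + \<kappa> i = q (i - r - 1) \<and> V < \<kappa> i \<and> \<kappa> i < W" if "r < i" "i \<le> r + s" for i
  proof -
    have "i - r - 1 < s"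
      using that by simp
    with q_mem(2,3)[OF this] that show ?thesis
      by (simp add: \<kappa>_def) linarith
  qed
  have \<kappa>_0: "\<kappa> 0 = 0"
    by (simp add: \<kappa>_def)
  have pos: "0 < g" "0 < h"
    using ab bc wf by (auto simp: wf_ograph_def)
  have \<kappa>_less_W: "\<kappa> i < W \<or> \<kappa> i = 0" if "i \<le> r + s" for i
    using \<kappa>_left[of i] \<kappa>_right[of i] \<kappa>_0 VW that by (metis less_le_trans not_gr_zero not_le)
  show ?thesis
  proof (rule contains_hinged_matchingI[OF wf])
    show "strict_mono_on {..r + s} \<kappa>"
    proof (rule strict_mono_onI)
      fix i j assume "i \<in> {..r + s}" "j \<in> {..r + s}" and less: "i < j"
      then have j: "j \<le> r + s"
        by simp
      consider "i = 0" "j \<le> r" | "i = 0" "r < j" | "0 < i" "j \<le> r" | "0 < i" "i \<le> r" "r < j" | "r < i"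
        by linarith
      then show "\<kappa> i < \<kappa> j"
      proof cases
        case 1
        then show ?thesis
          using \<kappa>_left[of j] \<kappa>_0 less by simp
      next
        case 2
        then show ?thesis
          using \<kappa>_right[of j] \<kappa>_0 j by simp
      next
        case 3
        then have "p (i - 1) < p (j - 1)"
          using less by (intro strict_mono_onD[OF p(1)]) auto
        moreover have "a + \<kappa> i = p (i - 1)" "a + \<kappa> j = p (j - 1)"
          using \<kappa>_left[of i] \<kappa>_left[of j] 3 less by simp_all
        ultimately show ?thesis
          by linarith
      next
        case 4
        then show ?thesis
          using \<kappa>_left[of i] \<kappa>_right[of j] j by simp
      next
        case 5
        then have "q (i - r - 1) < q (j - r - 1)"
          using less j by (intro strict_mono_onD[OF q(1)]) auto
        moreover have "b + \<kappa> i = q (i - r - 1)" "b + \<kappa> j = q (j - r - 1)"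
          using \<kappa>_right[of i] \<kappa>_right[of j] 5 less j by simp_all
        ultimately show ?thesis
          by linarith
      qed
    qed
  next
    show "a + \<kappa> r < b"
      using \<kappa>_less_W[of r] pos ab(2) by (auto simp: b_def)
  next
    show "b + \<kappa> (r + s) < b + h"
      using \<kappa>_less_W[of "r + s"] pos bc(2) by auto
  next
    fix i assume "i \<le> r"
    then have "(a + \<kappa> i, a + \<kappa> i + g) \<in> edges G"
      using \<kappa>_left[of i] p_mem(1)[of "i - 1"] ab(1) \<kappa>_0 by (cases "i = 0") simp_all
    then show "(a + \<kappa> i, b + \<kappa> i) \<in> edges G"
      by (simp add: b_def add.commute add.left_commute)
  next
    fix j assume "1 \<le> j" "j \<le> s"
    then have "(b + \<kappa> (r + j), b + \<kappa> (r + j) + h) \<in> edges G"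
      using \<kappa>_right[of "r + j"] q_mem(1)[of "j - 1"] by simp
    then show "(b + \<kappa> (r + j), (b + h) + \<kappa> (r + j)) \<in> edges G"
      by (simp add: add_ac)
  qed (use bc(1) \<kappa>_0 in \<open>simp_all add: b_def\<close>)
qed

text \<open>The set \<open>R\<close> of discarded edges accounts for the second summand. What is left contains no path
  with two edges, so every edge goes from the set of lower ends to its complement, and the cut bound
  gives the first summand.\<close>

lemma card_edges_le_of_no_hinged_matching:
  assumes B: "finite B" "sidon B" "B \<subseteq> {..M}" and spread: "\<And>g. g \<in> gaps B \<Longrightarrow> W \<le> g"
    and V: "0 < V" "V \<le> W"
    and H: "subgraph H (difference_graph n (gaps B))" "\<not> contains_copy H (hinged_matching r s)"
  shows "8 * card (edges H) \<le> (card B)\<^sup>2 * (n + M)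
    + 8 * (card (gaps B) * (r * (n div V + 1) + (s + V) * (n div W + 1)))"
proof -
  let ?D = "gaps B" and ?E = "edges H"
  define S where "S g = {x. (x, x + g) \<in> ?E}" for g
  define poor1 where "poor1 g = {x \<in> S g. card (S g \<inter> {x<..<x + V}) < r}" for g
  define poor2 where "poor2 g = {x \<in> S g. card (S g \<inter> {x<..<x + W}) < s + V}" for g
  define R where "R = (\<Union>g\<in>?D. (\<lambda>x. (x, x + g)) ` (poor1 g \<union> poor2 g))"
  have wf: "wf_ograph H" and sub: "?E \<subseteq> edges (difference_graph n ?D)"
    using H(1) by (auto simp: subgraph_def)
  have S: "S g \<subseteq> {..<n}" for g
    using sub by (auto simp: S_def difference_graph_def)
  have fin: "finite (poor1 g \<union> poor2 g)" for g
    using S[of g] by (auto intro: finite_subset simp: poor1_def poor2_def)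
  have "card R \<le> (\<Sum>g\<in>?D. card ((\<lambda>x. (x, x + g)) ` (poor1 g \<union> poor2 g)))"
    unfolding R_def by (intro card_UN_le finite_gaps B)
  also have "\<dots> \<le> (\<Sum>g\<in>?D. r * (n div V + 1) + (s + V) * (n div W + 1))"
  proof (rule sum_mono)
    fix g
    have "card ((\<lambda>x. (x, x + g)) ` (poor1 g \<union> poor2 g)) \<le> card (poor1 g) + card (poor2 g)"
      by (rule order_trans[OF card_image_le[OF fin] card_Un_le])
    also have "\<dots> \<le> r * (n div V + 1) + (s + V) * (n div W + 1)"
      unfolding poor1_def poor2_def
      using V by (intro add_mono card_points_with_few_successors S) auto
    finally show "card ((\<lambda>x. (x, x + g)) ` (poor1 g \<union> poor2 g))
      \<le> r * (n div V + 1) + (s + V) * (n div W + 1)" .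
  qed
  finally have card_R: "card R \<le> card ?D * (r * (n div V + 1) + (s + V) * (n div W + 1))"
    by simp

  define X where "X = fst ` (?E - R)"
  have X: "X \<subseteq> {..<n}"
    using sub by (auto simp: X_def difference_graph_def)
  have no_path: "False" if ab: "(a, b) \<in> ?E - R" and bc: "(b, c) \<in> ?E - R" for a b c
  proof -
    define g h where "g = b - a" and "h = c - b"
    have "a < b" "b < c" and gh: "g \<in> ?D" "h \<in> ?D"
      using ab bc sub by (auto simp: g_def h_def difference_graph_def)
    then have b: "b = a + g" and c: "c = a + g + h"
      by (simp_all add: g_def h_def)
    have "a \<in> S g" "b \<in> S h"
      using ab bc b c by (auto simp: S_def)
    moreover have "a \<notin> poor1 g" "b \<notin> poor2 h"
      using ab bc b c gh by (auto simp: R_def)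
    ultimately have "r \<le> card (S g \<inter> {a<..<a + V})" "s + V \<le> card (S h \<inter> {b<..<b + W})"
      by (auto simp: poor1_def poor2_def)
    then have "contains_copy H (hinged_matching r s)"
      using ab bc gh unfolding b c S_def
      by (intro contains_hinged_matching_of_windows[OF wf _ spread _ spread V(2)]) auto
    with H(2) show False ..
  qed
  have "?E - R \<subseteq> {(x, y) \<in> edges (difference_graph n ?D). x \<in> X \<and> y \<notin> X}"
    using sub no_path by (force simp: X_def)
  then have "card (?E - R) \<le> card {(x, y) \<in> edges (difference_graph n ?D). x \<in> X \<and> y \<notin> X}"
    by (rule card_mono[rotated])
      (rule finite_subset[OF _ finite_edges[OF wf_difference_graph]], auto)
  then have "8 * card (?E - R) \<le> (card B)\<^sup>2 * (n + M)"
    using card_directed_cut_difference_graph[OF B X] by linarith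
  moreover have "finite R"
    using fin finite_gaps[OF B(1)] by (auto simp: R_def)
  then have "card ?E \<le> card (?E - R) + card R"
    using diff_card_le_card_Diff[of R ?E] by linarith
  ultimately show ?thesis
    using card_R by linarith
qed

section \<open>The relative density\<close>

text \<open>The difference \<open>2 ^ k - 2 ^ l\<close> is at least \<open>2 ^ (k - 1)\<close>, so it exceeds every difference of
  smaller powers: the largest power is determined by the difference.\<close>

lemma sidon_dyadic: "sidon ((\<lambda>i. W * 2 ^ i) ` A)" if "0 < W" for W :: nat
proof -
  have top_less: "(2::nat) ^ i + 2 ^ l < 2 ^ k + 2 ^ j" if "i < k" "l < k" for i j k l :: nat
  proof -
    have "(2::nat) ^ i \<le> 2 ^ (k - 1)" "(2::nat) ^ l \<le> 2 ^ (k - 1)"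
      using that by (auto intro!: power_increasing)
    moreover have "(2::nat) ^ k = 2 ^ (k - 1) + 2 ^ (k - 1)"
      using that by (cases k) auto
    ultimately show ?thesis
      by (metis add_mono le_less_trans less_add_same_cancel1 zero_less_numeral zero_less_power)
  qed
  have "i = k \<and> j = l" if "j < i" "l < k" "W * 2 ^ i - W * 2 ^ j = W * 2 ^ k - W * 2 ^ l"
    for i j k l :: nat
  proof -
    have "W * (2 ^ i - 2 ^ j) = W * (2 ^ k - 2 ^ l)"
      using that(3) by (simp add: diff_mult_distrib2)
    then have "(2::nat) ^ i - 2 ^ j = 2 ^ k - 2 ^ l"
      using \<open>0 < W\<close> by simp
    moreover have "(2::nat) ^ j \<le> 2 ^ i" "(2::nat) ^ l \<le> 2 ^ k"
      using that by (auto intro!: power_increasing)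
    ultimately have "(2::nat) ^ i + 2 ^ l = 2 ^ k + 2 ^ j"
      by linarith
    moreover from this have "i = k"
      using top_less[of i k l j] top_less[of k i j l] that by (metis add.commute less_irrefl linorder_neqE_nat)
    ultimately show ?thesis
      by simp
  qed
  then show ?thesis
    using that by (fastforce simp: sidon_def)
qed

lemma gap_dyadic_bounds:
  assumes "g \<in> gaps ((\<lambda>i. W * 2 ^ i) ` {..<m})" "0 < W"
  shows "W \<le> g" "g \<le> W * 2 ^ m"
proof -
  obtain i j where g: "g = W * 2 ^ i - W * 2 ^ j" "j < i" "i < m"
    using assms by (auto simp: gaps_def)
  have "(2::nat) ^ j < 2 ^ i" "(2::nat) ^ i \<le> 2 ^ m"
    using g by (auto intro: power_increasing)
  then have "1 \<le> (2::nat) ^ i - 2 ^ j" "(2::nat) ^ i - 2 ^ j \<le> 2 ^ m"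
    by linarith+
  moreover have "g = W * (2 ^ i - 2 ^ j)"
    using g by (simp add: diff_mult_distrib2)
  ultimately show "W \<le> g" "g \<le> W * 2 ^ m"
    using mult_le_mono2[of 1 "2 ^ i - 2 ^ j" W] by (simp_all only: mult_1_right mult_le_mono2)
qed

text \<open>The host graph for the parameter \<open>k\<close> has \<open>m = k\<close>, windows \<open>V = k\<close> and \<open>W = k\<^sup>2\<close>, and \<open>n = k M\<close>.
  Per gap, about \<open>r n / V + (s + V) n / W\<close> edges are discarded and at most \<open>M\<close> are lost at the right
  end of the vertex set; both are \<open>O(n / k)\<close>.\<close>

lemma rel_turan_density_hinged_matching_le:
  fixes k :: nat
  assumes k: "2 \<le> k"
  defines "M \<equiv> k\<^sup>2 * 2 ^ k" and "n \<equiv> k ^ 3 * 2 ^ k"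
  shows "rel_turan_density (hinged_matching r s)
    \<le> (real k * real (n + M) / (4 * (real k - 1)) + (r * (n / k + 1) + (s + real k) * (n / k\<^sup>2 + 1)))
      / (real n - M)"
proof -
  define B where "B = (\<lambda>i. k\<^sup>2 * 2 ^ i) ` {..<k}"
  define G where "G = difference_graph n (gaps B)"
  let ?F = "hinged_matching r s" and ?e = "real (card (edges G))" and ?d = "real (card (gaps B))"
  have W: "0 < k\<^sup>2" "k \<le> k\<^sup>2"
    using k by (auto simp: power2_eq_square)
  have fin: "finite B" and sid: "sidon B"
    unfolding B_def using sidon_dyadic[OF W(1)] by auto
  have "B \<subseteq> {..M}"
    by (auto simp: B_def M_def intro!: power_increasing)
  have "inj_on (\<lambda>i. k\<^sup>2 * 2 ^ i) {..<k}"
    using k by (auto simp: inj_on_def)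
  then have card_B: "card B = k"
    by (simp add: B_def card_image)
  have "M < n"
    using k by (simp add: M_def n_def power2_eq_square power3_eq_cube)
  have gaps: "k\<^sup>2 \<le> g" "g \<le> M" if "g \<in> gaps B" for g
    using gap_dyadic_bounds[of g "k\<^sup>2" k] that W(1) by (auto simp: B_def M_def)
  have "real (2 * card (gaps B)) = real (k * (k - 1))"
    using card_gaps[OF fin sid] card_B by simp
  then have d: "2 * ?d = real k * (real k - 1)"
    using k by (simp add: of_nat_diff)
  moreover have "0 < real k * (real k - 1)"
    using k by simp
  ultimately have "0 < ?d"
    by linarith
  have wf: "wf_ograph G"
    by (simp add: G_def wf_difference_graph)
  have "gaps B \<subseteq> {1..M}"
    using gaps W by force
  then have "card (gaps B) * (n - M) \<le> card (edges G)"
    unfolding G_def by (intro card_difference_graph_ge finite_gaps fin)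
  then have "real (card (gaps B) * (n - M)) \<le> ?e"
    by (simp only: of_nat_le_iff)
  then have e: "?d * (real n - M) \<le> ?e"
    using \<open>M < n\<close> by (simp add: of_nat_diff)
  have "0 < ?d * (real n - M)"
    using \<open>0 < ?d\<close> \<open>M < n\<close> by simp
  with e have "0 < ?e"
    by linarith
  then have "edges G \<noteq> {}"
    by auto
  let ?t = "r * (n div k + 1) + (s + k) * (n div k\<^sup>2 + 1)"
  obtain H where H: "subgraph H G" "\<not> contains_copy H ?F" "card (edges H) = ex_ord G ?F"
    using ex_ord_hinged_matching_attained[OF wf] .
  have "8 * card (edges H) \<le> (card B)\<^sup>2 * (n + M) + 8 * (card (gaps B) * ?t)"
    using k H by (intro card_edges_le_of_no_hinged_matching[OF fin sid \<open>B \<subseteq> {..M}\<close> gaps(1) _ W(2)])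
      (simp_all add: G_def)
  then have "8 * ex_ord G ?F \<le> k\<^sup>2 * (n + M) + 8 * (card (gaps B) * ?t)"
    unfolding card_B H(3) .
  then have "real (8 * ex_ord G ?F) \<le> real (k\<^sup>2 * (n + M) + 8 * (card (gaps B) * ?t))"
    by (simp only: of_nat_le_iff)
  then have "8 * real (ex_ord G ?F) \<le> (real k)\<^sup>2 * (n + M) + 8 * (?d * real ?t)"
    by (simp only: of_nat_mult of_nat_add of_nat_power of_nat_numeral)
  moreover have "(real k)\<^sup>2 * (n + M) = 8 * (?d * (real k * real (n + M) / (4 * (real k - 1))))"
  proof -
    have d': "?d = real k * (real k - 1) / 2" and "real k - 1 \<noteq> 0"
      using d k by auto
    then show ?thesis
      unfolding d' power2_eq_square by (simp add: divide_simps)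
  qed
  ultimately have "real (ex_ord G ?F) \<le> ?d * (real k * real (n + M) / (4 * (real k - 1)) + real ?t)"
    unfolding distrib_left by linarith
  also have "real ?t \<le> r * (n / k + 1) + (s + real k) * (n / k\<^sup>2 + 1)"
  proof -
    have "real (n div k) \<le> n / k" "real (n div k\<^sup>2) \<le> n / k\<^sup>2"
      using of_nat_div_le_of_nat[of n k, where 'a = real] of_nat_div_le_of_nat[of n "k\<^sup>2", where 'a = real]
      by simp_all
    then show ?thesis
      unfolding of_nat_add of_nat_mult of_nat_1 by (intro add_mono mult_left_mono) auto
  qed
  finally have ex: "real (ex_ord G ?F) \<le> ?d * (real k * real (n + M) / (4 * (real k - 1))
      + (r * (n / k + 1) + (s + real k) * (n / k\<^sup>2 + 1)))" (is "_ \<le> ?d * ?t'")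
    using \<open>0 < ?d\<close> by simp
  have "rel_turan_density ?F \<le> real (ex_ord G ?F) / ?e"
    unfolding rel_turan_density_def using wf \<open>edges G \<noteq> {}\<close>
    by (intro cINF_lower bdd_belowI[of _ 0]) auto
  also have "\<dots> \<le> (?d * ?t') / (?d * (real n - M))"
    using ex e \<open>0 < ?d * (real n - M)\<close> by (intro frac_le) auto
  also have "\<dots> = ?t' / (real n - M)"
    using \<open>0 < ?d\<close> by simp
  finally show ?thesis .
qed

lemma rel_turan_density_hinged_matching: "rel_turan_density (hinged_matching r s) = 1 / 4"
proof (rule antisym)
  have "((\<lambda>k. (real k * (real k ^ 3 * 2 ^ k + (real k)\<^sup>2 * 2 ^ k) / (4 * (real k - 1))
      + (real r * (real k ^ 3 * 2 ^ k / real k + 1)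
        + (real s + real k) * (real k ^ 3 * 2 ^ k / (real k)\<^sup>2 + 1)))
      / (real k ^ 3 * 2 ^ k - (real k)\<^sup>2 * 2 ^ k)) \<longlongrightarrow> 1 / 4) sequentially"
    by real_asymp
  then show "rel_turan_density (hinged_matching r s) \<le> 1 / 4"
    by (rule tendsto_lowerbound)
      (use rel_turan_density_hinged_matching_le[of _ r s] in
        \<open>auto simp: eventually_at_top_linorder intro!: exI[of _ 2]\<close>)
next
  let ?\<G> = "{G. wf_ograph G \<and> edges G \<noteq> {}}"
  have "\<lparr>verts = {0, 1}, edges = {(0, 1)}\<rparr> \<in> ?\<G>"
    by (simp add: wf_ograph_def)
  then have "?\<G> \<noteq> {}"
    by blast
  then show "1 / 4 \<le> rel_turan_density (hinged_matching r s)"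
    unfolding rel_turan_density_def
  proof (rule cINF_greatest)
    fix G assume G: "G \<in> ?\<G>"
    then have "card (edges G) > 0"
      using finite_edges by (simp add: card_gt_0_iff)
    moreover have "real (card (edges G)) \<le> 4 * real (ex_ord G (hinged_matching r s))"
      using quarter_le_ex_ord_hinged_matching[of G r s] G by (simp flip: of_nat_le_iff)
    ultimately show "1 / 4 \<le> real (ex_ord G (hinged_matching r s)) / real (card (edges G))"
      by (simp add: field_simps)
  qed
qed

theorem corollary3p8:
  fixes r s :: nat
  shows "rel_turan_density (hinged_matching r s) = template_lambda (hinged_matching r s)
    \<and> template_lambda (hinged_matching r s) = 1 / 4"
  by (simp add: rel_turan_density_hinged_matching template_lambda_hinged_matching)

end
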